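(* Let $k_0\in\mathbb{N}$ be fixed. There is $L_0\in\mathbb{N}$ (sufficiently large) such that the following holds for all $L\in\mathbb{N}$ with $L\ge L_0$, all $U\in(0,\pi/2)$, all $\Delta_3,\Delta_4>0$ with $\Delta_3\neq\Delta_4$, and all integers $k_1,k_2$ with $1\le k_1,k_2\le k_0$. The set of functions $$f_1(t)=\sin^2 t,\quad f_2(t)=\cos^2 t,\quad f_3(t)=(t-\pi L)^{\Delta_3},\quad f_4(t)=(t-\pi L)^{\Delta_4},\qquad t\in[\pi L,\pi L+U],$$ generates the following formula: there exist points $(\alpha_0^{i,k},\dots,\alpha_k^{i,k})$ generated by $f_i$ at $(U,L,k)$ (for $i=1$, $k=k_1$; for $i=2$, $k=k_2$; and for $i=3,4$, $k\in\{k_1,k_2\}$), and for such points $$ \frac{\prod_{r=1}^{k_2}\tilde Z^2(\alpha_r^{2,k_2})\,[\tilde Z^2(\alpha_r^{3,k_2})]^{\frac{\Delta_4}{\Delta_3-\Delta_4}}\,[\tilde Z^2(\alpha_r^{4,k_2})]^{\frac{-\Delta_3}{\Delta_3-\Delta_4}}}{\left(\frac{\alpha_0^{4,k_2}-\pi L}{\alpha_0^{3,k_2}-\pi L}\right)^{\frac{\Delta_3\Delta_4}{\Delta_3-\Delta_4}}}\cos^2(\alpha_0^{2,k_2}) $$ $$ +\frac{\prod_{r=1}^{k_1}\tilde Z^2(\alpha_r^{1,k_1})\,[\tilde Z^2(\alpha_r^{3,k_1})]^{\frac{\Delta_4}{\Delta_3-\Delta_4}}\,[\tilde Z^2(\alpha_r^{4,k_1})]^{\frac{-\Delta_3}{\Delta_3-\Delta_4}}}{\left(\frac{\alpha_0^{4,k_1}-\pi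 L}{\alpha_0^{3,k_1}-\pi L}\right)^{\frac{\Delta_3\Delta_4}{\Delta_3-\Delta_4}}}\sin^2(\alpha_0^{1,k_1}) =\left[\frac{(1+\Delta_4)^{1/\Delta_4}}{(1+\Delta_3)^{1/\Delta_3}}\right]^{\frac{\Delta_3\Delta_4}{\Delta_3-\Delta_4}} . $$ (Each product sign extends over all three $\tilde Z^2$-factors in its numerator.)
   Context: Jacob's ladder. Let $\mu\in C^\infty([y_0,\infty))$ be a fixed increasing function, unbounded above, with $\mu(y)\ge 7y\ln y$. For all sufficiently large $T$ let $x=\varphi(T)$ be the solution of $$\int_0^{\mu(x)}\left|\zeta\left(\tfrac12+it\right)\right|^2e^{-2t/x}\,dt=\int_0^T\left|\zeta\left(\tfrac12+it\right)\right|^2dt .$$ The Jacob's ladder is $\varphi_1(T)=\tfrac12\varphi(T)$; it is a continuously differentiable, strictly increasing function for $T\ge T_0$ ($T_0$ large), with $\varphi_1(T)<T$ and $\varphi_1(T)\to\infty$ as $T\to\infty$. Put $$\tilde Z^2(t)=\frac{d\varphi_1(t)}{dt}=\frac{|\zeta(\frac12+it)|^2}{\omega(t)},\qquad \omega(t)=\left\{1+O\left(\frac{\ln\ln t}{\ln t}\right)\right\}\ln t .$$ Thus $\tilde Z^2\ge 0$. Reverse iterations. For large $L\in\mathbb{N}$ and $U\in(0,\pi/2)$ set $a_0=\pi L$, $b_0=\pi L+U$, and define $a_r,b_r$ ($r\ge1$) by $\varphi_1(a_r)=a_{r-1}$, $\varphi_1(b_r)=b_{r-1}$. The segment $[a_r,b_r]$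 is the $r$-th reverse iteration of $[\pi L,\pi L+U]$. Generated points. Let $f\ge0$ be a continuous function, not identically zero, on $[\pi L,\pi L+U]$, and let $k\ge1$. Points $(\alpha_0,\dots,\alpha_k)$ are said to be generated by $f$ at $(U,L,k)$ if $\alpha_k\in(a_k,b_k)$, $\alpha_{r-1}=\varphi_1(\alpha_r)$ for $r=1,\dots,k$ (so $\alpha_0\in(\pi L,\pi L+U)$ and $\alpha_r\in(a_r,b_r)$), and $$\int_{\pi L}^{\pi L+U}f(t)\,dt=f(\alpha_0)\left(\prod_{r=1}^k\tilde Z^2(\alpha_r)\right)(b_k-a_k).$$ (This is the mean value theorem applied to the integral after the substitution by the $k$-th iterate of $\varphi_1$.) *)

theory Defs
  imports "HOL-Complex_Analysis.Complex_Analysis"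
begin

text \<open>
  The Riemann zeta function, as the analytic continuation of its Dirichlet series from
  \<open>Re s > 1\<close> to \<open>Re s > 0\<close>, \<open>s \<noteq> 1\<close>.
  The domain is connected, so the values there are uniquely determined by the two conditions
  (identity theorem); values outside that domain carry no meaning and are never used, only
  the critical line matters here.
\<close>

definition zeta :: "complex \<Rightarrow> complex" where
  "zeta = (SOME f. f holomorphic_on ({s. 0 < Re s} - {1}) \<and>
     (\<forall>s. 1 < Re s \<longrightarrow> (\<lambda>n. of_nat (Suc n) powr (- s)) sums f s))"

text \<open>
  \<open>C_infinity_on S f\<close>: derivatives are taken within \<open>S\<close>, i.e. they are
  one-sided at an end point of an interval \<open>S\<close>.
\<close>

definition C_infinity_on :: "real set \<Rightarrow> (real \<Rightarrow> real) \<Rightarrow> bool" where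
  "C_infinity_on S f \<longleftrightarrow> (\<exists>D :: nat \<Rightarrow> real \<Rightarrow> real.
     (\<forall>y\<in>S. D 0 y = f y) \<and>
     (\<forall>n. \<forall>y\<in>S. (D n has_real_derivative D (Suc n) y) (at y within S)))"

definition ladder_equation :: "(real \<Rightarrow> real) \<Rightarrow> real \<Rightarrow> real \<Rightarrow> real \<Rightarrow> bool" where
  "ladder_equation \<mu> y0 T x \<longleftrightarrow> y0 \<le> x \<and>
     integral {0..\<mu> x} (\<lambda>t. (cmod (zeta (Complex (1/2) t)))\<^sup>2 * exp (- 2 * t / x)) =
     integral {0..T} (\<lambda>t. (cmod (zeta (Complex (1/2) t)))\<^sup>2)"

text \<open>
  The ladder is only meaningful where the equation determines \<open>x\<close>; for the functions
  \<open>\<mu>\<close> considered, the following set contains all sufficiently large \<open>T\<close>.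
\<close>

definition ladder_domain :: "(real \<Rightarrow> real) \<Rightarrow> real \<Rightarrow> real set" where
  "ladder_domain \<mu> y0 = {T. 0 < T \<and> (\<exists>!x. ladder_equation \<mu> y0 T x)}"

definition ladder_phi :: "(real \<Rightarrow> real) \<Rightarrow> real \<Rightarrow> real \<Rightarrow> real" where
  "ladder_phi \<mu> y0 T = (THE x. ladder_equation \<mu> y0 T x)"

definition jacobs_ladder :: "(real \<Rightarrow> real) \<Rightarrow> real \<Rightarrow> real \<Rightarrow> real" where
  "jacobs_ladder \<mu> y0 T = ladder_phi \<mu> y0 T / 2"

text \<open>This is \<open>Z\<^sup>2\<close> with a tilde: the square belongs to the name of the function.\<close>

definition Z2_tilde :: "(real \<Rightarrow> real) \<Rightarrow> real \<Rightarrow> real \<Rightarrow> real" where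
  "Z2_tilde \<mu> y0 t = deriv (jacobs_ladder \<mu> y0) t"

text \<open>
  With \<open>c = \<pi> L\<close> and \<open>c = \<pi> L + U\<close> this gives the end points
  \<open>a\<^sub>r\<close> and \<open>b\<^sub>r\<close> of the reverse iterations.
\<close>

primrec reverse_iterate :: "(real \<Rightarrow> real) \<Rightarrow> real \<Rightarrow> real \<Rightarrow> nat \<Rightarrow> real" where
  "reverse_iterate \<mu> y0 c 0 = c"
| "reverse_iterate \<mu> y0 c (Suc r) =
     (THE T. T \<in> ladder_domain \<mu> y0 \<and> jacobs_ladder \<mu> y0 T = reverse_iterate \<mu> y0 c r)"

text \<open>
  Only the values \<open>\<alpha> 0, \<dots>, \<alpha> k\<close> are constrained; the sequence
  \<open>\<alpha>\<close> stands for the tuple of these.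
\<close>

definition generated_points ::
  "(real \<Rightarrow> real) \<Rightarrow> real \<Rightarrow> (real \<Rightarrow> real) \<Rightarrow> real \<Rightarrow> nat \<Rightarrow> nat \<Rightarrow> (nat \<Rightarrow> real) \<Rightarrow> bool" where
  "generated_points \<mu> y0 f U L k \<alpha> \<longleftrightarrow>
     (let I = {pi * real L .. pi * real L + U};
          a = reverse_iterate \<mu> y0 (pi * real L);
          b = reverse_iterate \<mu> y0 (pi * real L + U)
      in continuous_on I f \<and> (\<forall>t\<in>I. 0 \<le> f t) \<and> (\<exists>t\<in>I. f t \<noteq> 0) \<and> 1 \<le> k \<and>
         \<alpha> k \<in> {a k <..< b k} \<and>
         (\<forall>r\<in>{1..k}. \<alpha> (r - 1) = jacobs_ladder \<mu> y0 (\<alpha> r)) \<and>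
         integral I f = f (\<alpha> 0) * (\<Prod>r = 1..k. Z2_tilde \<mu> y0 (\<alpha> r)) * (b k - a k))"

end

theory Submission
  imports Defs
begin

text \<open>
  Write \<open>A\<^sub>i\<close> for the product of the \<open>Z\<^sup>2\<close>-values along the points generated by \<open>f\<^sub>i\<close>, and \<open>D = b\<^sub>k - a\<^sub>k\<close>.
  The relations for \<open>f\<^sub>3\<close> and \<open>f\<^sub>4\<close> give \<open>D\<close> as a monomial in \<open>A\<^sub>3\<close>, \<open>A\<^sub>4\<close>, \<open>U\<close> and the points \<open>\<alpha>\<^sub>0\<close>; inserting
  this into the relations for \<open>sin\<^sup>2\<close> and \<open>cos\<^sup>2\<close> and adding, the identity reduces to
  \<open>\<integral> sin\<^sup>2 + \<integral> cos\<^sup>2 = U\<close>.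

  The existence of the ladder needs no asymptotics of the zeta function. With
  \<open>F x = \<integral>\<^sub>0\<^sup>\<mu>\<^sup>(\<^sup>x\<^sup>) |\<zeta>|\<^sup>2 exp (-2t/x) dt\<close> and \<open>G T = \<integral>\<^sub>0\<^sup>T |\<zeta>|\<^sup>2 dt\<close>, both functions are strictly increasing with the same
  supremum (finite or not), which neither attains, since \<open>\<zeta>\<close> vanishes on no segment of the critical line.
  So \<open>\<phi> = F\<^sup>-\<^sup>1 \<circ> G\<close> is an increasing bijection between neighbourhoods of infinity. In particular
  its inverse tends to infinity, so that for fixed \<open>k\<^sub>0\<close> the first \<open>k\<^sub>0\<close> reverse iterates of a
  large point are large; the inequality \<open>\<phi>\<^sub>1 T < T\<close> is not involved.
\<close>

subsection \<open>Elementary integrals\<close>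

text \<open>Turns one nonzero value into a strict inequality. The strict monotonicity of both sides
  of the ladder equation rests on it.\<close>

lemma integral_pos_continuous:
  fixes f :: "real \<Rightarrow> real"
  assumes "a < b" "continuous_on {a..b} f" "\<And>x. x \<in> {a..b} \<Longrightarrow> 0 \<le> f x"
    and "c \<in> {a..b}" "f c \<noteq> 0"
  shows "0 < integral {a..b} f"
proof -
  have "integral {a..b} f \<noteq> 0"
    using integral_eq_0_iff[of a b f] assms by blast
  moreover have "0 \<le> integral {a..b} f"
    using assms by (intro integral_nonneg integrable_continuous_real) auto
  ultimately show ?thesis by simp
qed

lemma integral_powr_shift:
  fixes c U p :: real
  assumes "0 < U" "0 < p"
  shows "integral {c..c + U} (\<lambda>t. (t - c) powr p) = U powr (p + 1) / (p + 1)"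
proof -
  have "((\<lambda>t. (t - c) powr p) has_integral
      (c + U - c) powr (p + 1) / (p + 1) - (c - c) powr (p + 1) / (p + 1)) {c..c + U}"
  \<comment> \<open>At \<open>t = c\<close> the base of the power is 0, so the derivative is taken
    in the open interval only.\<close>
  proof (rule fundamental_theorem_of_calculus_interior)
    show "continuous_on {c..c + U} (\<lambda>t. (t - c) powr (p + 1) / (p + 1))"
      using assms by (intro continuous_intros continuous_on_powr') auto
    fix t assume "t \<in> {c<..<c + U}"
    then have "((\<lambda>t. (t - c) powr (p + 1) / (p + 1)) has_real_derivative (t - c) powr p) (at t)"
      using assms by (auto intro!: derivative_eq_intros)
    then show "((\<lambda>t. (t - c) powr (p + 1) / (p + 1)) has_vector_derivative (t - c) powr p) (at t)"
      by (simp add: has_real_derivative_iff_has_vector_derivative)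
  qed (use assms in auto)
  then show ?thesis using assms by (simp add: integral_unique)
qed

lemma integral_cos_sq_sin_sq:
  fixes a b :: real
  assumes "a \<le> b"
  shows "integral {a..b} (\<lambda>t. (cos t)\<^sup>2) + integral {a..b} (\<lambda>t. (sin t)\<^sup>2) = b - a"
proof -
  have "integral {a..b} (\<lambda>t. (cos t)\<^sup>2) + integral {a..b} (\<lambda>t. (sin t)\<^sup>2) =
      integral {a..b} (\<lambda>t. (cos t)\<^sup>2 + (sin t)\<^sup>2)"
    by (intro integral_add[symmetric] integrable_continuous_real continuous_intros)
  then show ?thesis using assms by simp
qed

text \<open>The exponents are chosen so that the interval lengths \<open>U\<close> and \<open>D\<close> enter with the powers
  \<open>-1\<close> and \<open>1\<close>, whatever \<open>p\<close> and \<open>q\<close> are.\<close>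

lemma powr_elimination:
  fixes p q x y U D A B :: real
  assumes pos: "0 < p" "0 < q" "p \<noteq> q" "0 < x" "0 < y" "0 < U" "0 < D"
    and A: "U powr (p + 1) / (p + 1) = x powr p * A * D"
    and B: "U powr (q + 1) / (q + 1) = y powr q * B * D"
  shows "A powr (q / (p - q)) * B powr (- p / (p - q)) / (y / x) powr (p * q / (p - q)) =
    D / U * ((1 + q) powr (1 / q) / (1 + p) powr (1 / p)) powr (p * q / (p - q))" (is "?L = ?R")
proof -
  \<comment> \<open>The sign of \<open>A\<close> is not assumed: all other factors of the relation
    are positive, which forces it. After that the claim is linear in logarithms.\<close>
  have ln_gen: "0 < A \<and> ln A = (p + 1) * ln U - ln (1 + p) - p * ln x - ln D"
    if "0 < p" "0 < x" "U powr (p + 1) / (p + 1) = x powr p * A * D" for p x A :: real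
  proof -
    have "A = U powr (p + 1) / ((p + 1) * x powr p * D)"
    proof -
      have "U powr (p + 1) = x powr p * A * D * (p + 1)" using that by (simp add: divide_eq_eq)
      then show ?thesis using that pos by simp
    qed
    then show ?thesis
      using that pos by (simp add: ln_div ln_mult ln_powr add.commute)
  qed
  note A' = ln_gen[OF pos(1,4) A] and B' = ln_gen[OF pos(2,5) B]
  have "ln ?L = q / (p - q) * ln A - p / (p - q) * ln B - p * q / (p - q) * (ln y - ln x)"
    using pos A' B' by (simp add: ln_div ln_mult ln_powr)
  also have "\<dots> = ln D - ln U + p * q / (p - q) * (1 / q * ln (1 + q) - 1 / p * ln (1 + p))"
    using pos A' B' by (simp add: divide_simps) (simp add: algebra_simps)
  also have "\<dots> = ln ?R"
    using pos by (simp add: ln_div ln_mult ln_powr)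
  finally have "ln ?L = ln ?R" .
  moreover have "0 < ?L" "0 < ?R" using pos A' B' by simp_all
  ultimately show ?thesis using ln_inj_iff by blast
qed

subsection \<open>The zeta function on the right half-plane\<close>

text \<open>The value of \<open>n\<^sup>-\<^sup>s - \<integral>\<^sub>n\<^sup>n\<^sup>+\<^sup>1 x\<^sup>-\<^sup>s dx\<close> at \<open>n = Suc m\<close>; these terms are
  summable for \<open>Re s > 0\<close>, and the integrals add up to \<open>1 / (s - 1)\<close> for \<open>Re s > 1\<close>.\<close>

definition zeta_term :: "nat \<Rightarrow> complex \<Rightarrow> complex" where
  "zeta_term m s = of_nat (Suc m) powr (-s) -
     (of_nat (Suc (Suc m)) powr (1 - s) - of_nat (Suc m) powr (1 - s)) / (1 - s)"

text \<open>The mean value inequality is applied twice on the segment from \<open>N\<close> to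
  \<open>N + 1\<close>: first to \<open>u powr (-s)\<close>, then to an antiderivative of
  \<open>u powr (-s) - N powr (-s)\<close>, whose increment is
  \<open>- zeta_term m s\<close>.\<close>

lemma norm_zeta_term_le:
  assumes s: "0 < Re s" "s \<noteq> 1"
  shows "norm (zeta_term m s) \<le> norm s * real (Suc m) powr (- Re s - 1)"
proof -
  define N :: complex where "N = of_nat (Suc m)"
  define S where "S = closed_segment N (N + 1)"
  define B where "B = norm s * real (Suc m) powr (- Re s - 1)"
  have S: "u \<in> \<real> \<and> real (Suc m) \<le> Re u \<and> Re u \<le> real (Suc m) + 1" if u: "u \<in> S" for u
  proof -
    obtain t where t: "0 \<le> t" "t \<le> 1" "u = (1 - t) *\<^sub>R N + t *\<^sub>R (N + 1)"
      using u unfolding S_def in_segment by blast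
    from t(3) have "u = of_real (real (Suc m) + t)"
      by (simp add: N_def scaleR_conv_of_real algebra_simps)
    with t(1,2) show ?thesis by simp
  qed
  have notneg: "u \<notin> \<real>\<^sub>\<le>\<^sub>0" "u \<noteq> 0" if "u \<in> S" for u
    using S[OF that] by (auto simp: complex_nonpos_Reals_iff)
  have NS: "N \<in> S" "N + 1 \<in> S" by (auto simp: S_def)
  have convex: "convex S" by (simp add: S_def)
  have B0: "0 \<le> B" by (simp add: B_def)
  have step1: "norm (u powr (-s) - N powr (-s)) \<le> B * norm (u - N)" if "u \<in> S" for u
  proof (rule field_differentiable_bound[OF convex _ _ that NS(1)])
    fix z assume z: "z \<in> S"
    show "((\<lambda>u. u powr (-s)) has_field_derivative (-s) * z powr (-s - 1)) (at z within S)"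
      using has_field_derivative_powr[OF notneg(1)[OF z]] has_field_derivative_at_within by blast
    have "norm (z powr (-s - 1)) = Re z powr (- Re s - 1)"
      using S[OF z] by (subst norm_powr_real_powr) auto
    also have "\<dots> \<le> real (Suc m) powr (- Re s - 1)"
      using S[OF z] s by (intro powr_mono2') auto
    finally show "norm ((-s) * z powr (-s - 1)) \<le> B"
      by (simp add: norm_mult B_def mult_left_mono)
  qed
  have "norm (((N + 1) powr (1 - s) / (1 - s) - (N + 1) * N powr (-s)) -
              (N powr (1 - s) / (1 - s) - N * N powr (-s))) \<le> B * norm ((N + 1) - N)"
  proof (rule field_differentiable_bound[OF convex, where
        f = "\<lambda>u. u powr (1 - s) / (1 - s) - u * N powr (-s)" and
        f' = "\<lambda>u. u powr (-s) - N powr (-s)"])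
    fix z assume z: "z \<in> S"
    have "((\<lambda>u. u powr (1 - s) / (1 - s) - u * N powr (-s)) has_field_derivative
       ((1 - s) * z powr (1 - s - 1)) / (1 - s) - 1 * N powr (-s)) (at z within S)"
      using has_field_derivative_powr[OF notneg(1)[OF z], of "1 - s"]
      by (intro DERIV_diff DERIV_cdivide DERIV_cmult_right DERIV_ident)
         (auto intro: has_field_derivative_at_within)
    then show "((\<lambda>u. u powr (1 - s) / (1 - s) - u * N powr (-s)) has_field_derivative
       z powr (-s) - N powr (-s)) (at z within S)"
      using s by simp
    have "norm (z - N) \<le> 1"
    proof -
      obtain x where x: "z = of_real x" using S[OF z] by (auto elim: Reals_cases)
      then have "z - N = of_real (x - real (Suc m))" by (simp add: N_def)
      then have "norm (z - N) = \<bar>x - real (Suc m)\<bar>" using norm_of_real by metis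
      then show ?thesis using S[OF z] x by simp
    qed
    then show "norm (z powr (-s) - N powr (-s)) \<le> B"
      using step1[OF z] mult_left_mono[OF _ B0, of "norm (z - N)" 1] by simp
  qed (use NS in auto)
  moreover have "((N + 1) powr (1 - s) / (1 - s) - (N + 1) * N powr (-s)) -
              (N powr (1 - s) / (1 - s) - N * N powr (-s)) = - zeta_term m s"
    by (simp add: zeta_term_def N_def algebra_simps diff_divide_distrib)
  ultimately show ?thesis
    by (simp add: B_def)
qed

lemma summable_Suc_powr: "s < -1 \<Longrightarrow> summable (\<lambda>n. real (Suc n) powr s)"
  using summable_Suc_iff[of "\<lambda>n. real n powr s"] summable_real_powr_iff[of s] by simp

lemma open_half_plane_punctured: "open ({s. 0 < Re s} - {1})"
  by (intro open_Diff open_halfspace_Re_gt) auto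

text \<open>Shows that the choice in \<open>zeta\<close> is not void. The continuation is
  \<open>g s - 1 / (1 - s)\<close>, where \<open>g\<close> is the sum of the
  \<open>zeta_term\<close> series and is holomorphic by locally uniform comparison.\<close>

lemma zeta_exists:
  "\<exists>f. f holomorphic_on ({s. 0 < Re s} - {1}) \<and>
     (\<forall>s. 1 < Re s \<longrightarrow> (\<lambda>n. of_nat (Suc n) powr (- s)) sums f s)"
proof -
  let ?S = "{s. 0 < Re s} - {1::complex}"
  have "\<exists>g g'. \<forall>s\<in>?S. (\<lambda>n. zeta_term n s) sums g s \<and> (\<lambda>n. deriv (zeta_term n) s) sums g' s \<and>
          (g has_field_derivative g' s) (at s)"
  proof (rule series_and_derivative_comparison_complex[OF open_half_plane_punctured])
    fix n s assume s: "s \<in> ?S"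
    have "zeta_term n holomorphic_on ?S"
      unfolding zeta_term_def by (intro holomorphic_intros) auto
    then show "(zeta_term n has_field_derivative deriv (zeta_term n) s) (at s)"
      using open_half_plane_punctured s by (rule holomorphic_derivI)
  next
    fix s assume s: "s \<in> ?S"
    \<comment> \<open>On the ball of radius \<open>d\<close> around \<open>s\<close> the real part
      stays at least \<open>d\<close>, so one summable majorant serves the whole ball.\<close>
    define d where "d = Re s / 2"
    define h where "h = (\<lambda>n. complex_of_real ((norm s + d) * real (Suc n) powr (- d - 1)))"
    have d: "0 < d" using s by (simp add: d_def)
    have sm: "summable (\<lambda>n. (norm s + d) * real (Suc n) powr (- d - 1))"
      using d by (intro summable_mult summable_Suc_powr) auto
    have "norm (zeta_term n z) \<le> norm (h n)" if z: "z \<in> ball s d \<inter> ?S" for n z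
    proof -
      have "norm (s - z) < d" using z by (simp add: dist_norm)
      then have 1: "norm z \<le> norm s + d" and 2: "d \<le> Re z"
        using norm_triangle_ineq2[of z s] abs_Re_le_cmod[of "s - z"]
        by (auto simp: norm_minus_commute d_def)
      have "norm (zeta_term n z) \<le> norm z * real (Suc n) powr (- Re z - 1)"
        using z by (intro norm_zeta_term_le) auto
      also have "\<dots> \<le> (norm s + d) * real (Suc n) powr (- d - 1)"
        using 1 2 d by (intro mult_mono powr_mono) auto
      also have "\<dots> = norm (h n)"
        using d unfolding h_def norm_of_real by simp
      finally show ?thesis .
    qed
    moreover have "summable h" unfolding h_def by (intro summable_of_real sm)
    moreover have "range h \<subseteq> \<real>\<^sub>\<ge>\<^sub>0"
      using d by (auto simp: h_def complex_nonneg_Reals_iff simp del: of_real_mult of_nat_Suc)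
    ultimately show "\<exists>d h. 0 < d \<and> summable h \<and> range h \<subseteq> \<real>\<^sub>\<ge>\<^sub>0 \<and>
       (\<forall>\<^sub>F n in sequentially. \<forall>y\<in>ball s d \<inter> ?S. cmod (zeta_term n y) \<le> cmod (h n))"
      using d by (intro exI[of _ d] exI[of _ h]) auto
  qed
  then obtain g g' where g: "\<And>s. s \<in> ?S \<Longrightarrow> (\<lambda>n. zeta_term n s) sums g s"
      and g': "\<And>s. s \<in> ?S \<Longrightarrow> (g has_field_derivative g' s) (at s)"
    by blast
  have "(\<lambda>s. g s - 1 / (1 - s)) holomorphic_on ?S"
  proof (intro holomorphic_intros)
    show "g holomorphic_on ?S"
      using g' by (meson holomorphic_onI field_differentiable_def field_differentiable_at_within)
  qed auto
  moreover have "(\<lambda>n. of_nat (Suc n) powr (- s)) sums (g s - 1 / (1 - s))" if s: "1 < Re s" for s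
  proof -
    have "(\<lambda>n. real (Suc n) powr (1 - Re s)) \<longlonglongrightarrow> 0"
      using s by (intro tendsto_neg_powr filterlim_compose[OF filterlim_real_sequentially filterlim_Suc]) auto
    moreover have "norm (of_nat (Suc n) powr (1 - s) :: complex) = real (Suc n) powr (1 - Re s)" for n
      by (subst norm_powr_real_powr) auto
    ultimately have "(\<lambda>n. of_nat (Suc n) powr (1 - s) :: complex) \<longlonglongrightarrow> 0"
      using tendsto_norm_zero_iff[of "\<lambda>n. of_nat (Suc n) powr (1 - s) :: complex"] by simp
    \<comment> \<open>The integral parts of the terms telescope; for \<open>Re s > 1\<close> the
      boundary value at infinity is 0, which leaves \<open>- 1 / (1 - s)\<close> after
      division.\<close>
    then have "(\<lambda>n. of_nat (Suc (Suc n)) powr (1 - s) - of_nat (Suc n) powr (1 - s) :: complex) sums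
        (0 - of_nat (Suc 0) powr (1 - s))"
      by (rule telescope_sums)
    then have "(\<lambda>n. (of_nat (Suc (Suc n)) powr (1 - s) - of_nat (Suc n) powr (1 - s)) / (1 - s)) sums
        ((0 - of_nat (Suc 0) powr (1 - s)) / (1 - s))"
      by (rule sums_divide)
    moreover have "s \<in> ?S" using s by auto
    ultimately have "(\<lambda>n. zeta_term n s + (of_nat (Suc (Suc n)) powr (1 - s) - of_nat (Suc n) powr (1 - s)) / (1 - s))
        sums (g s + (0 - of_nat (Suc 0) powr (1 - s)) / (1 - s))"
      by (intro sums_add g)
    then show ?thesis
      unfolding zeta_term_def by (simp add: of_nat_Suc [of 0] del: of_nat_Suc)
  qed
  ultimately show ?thesis by blast
qed

lemma zeta_holomorphic: "zeta holomorphic_on ({s. 0 < Re s} - {1})"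
  and zeta_sums: "1 < Re s \<Longrightarrow> (\<lambda>n. of_nat (Suc n) powr (- s)) sums zeta s"
  using someI_ex[OF zeta_exists] unfolding zeta_def[symmetric] by auto

text \<open>One nonzero value, needed to contradict the identity theorem. At 2 the Dirichlet series
  has positive real terms.\<close>

lemma zeta_2_nonzero: "zeta 2 \<noteq> 0"
proof
  assume "zeta 2 = 0"
  then have "(\<lambda>n. Re (of_nat (Suc n) powr (- 2))) sums 0"
    using sums_Re[OF zeta_sums[of 2]] by simp
  moreover have "Re (of_nat (Suc n) powr (- 2)) = real (Suc n) powr (- 2)" for n
  proof -
    have "(of_nat (Suc n) :: complex) powr (- 2) = of_real (real (Suc n) powr (- 2))"
      using powr_of_real[of "real (Suc n)" "-2"] by simp
    then show ?thesis by (metis Re_complex_of_real)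
  qed
  ultimately have "(\<lambda>n. real (Suc n) powr (- 2)) sums 0" by simp
  then have "(\<Sum>n. real (Suc n) powr (- 2)) = 0" "summable (\<lambda>n. real (Suc n) powr (- 2))"
    by (auto simp: sums_iff)
  moreover have "0 < (\<Sum>n. real (Suc n) powr (- 2))"
    using calculation(2) by (rule suminf_pos) auto
  ultimately show False by simp
qed

section \<open>Zeros on the critical line and the mean square integral\<close>

definition critical_sq :: "real \<Rightarrow> real" where
  "critical_sq t = (cmod (zeta (Complex (1/2) t)))\<^sup>2"

lemma critical_sq_nonneg: "0 \<le> critical_sq t"
  by (simp add: critical_sq_def)

lemma continuous_on_critical_sq [continuous_intros]: "continuous_on S critical_sq"
proof -
  have "continuous_on S (\<lambda>t. zeta (Complex (1/2) t))"
  proof (rule continuous_on_compose2[OF holomorphic_on_imp_continuous_on[OF zeta_holomorphic]])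
    show "continuous_on S (Complex (1/2))"
      by (auto simp: Complex_eq intro!: continuous_intros)
  qed (auto simp: complex_eq_iff)
  then show ?thesis unfolding critical_sq_def by (intro continuous_intros)
qed

text \<open>If zeta vanished on a segment of the critical line, the identity theorem on the
  connected punctured half-plane would give \<open>zeta 2 = 0\<close>.\<close>

lemma critical_sq_nonzero_between:
  assumes "a < b"
  shows "\<exists>t. a < t \<and> t < b \<and> critical_sq t \<noteq> 0"
proof (rule ccontr)
  assume neg: "\<not> (\<exists>t. a < t \<and> t < b \<and> critical_sq t \<noteq> 0)"
  let ?S = "{s. 0 < Re s} - {1::complex}"
  let ?c = "Complex (1/2) ((a + b) / 2)"
  have "zeta 2 = 0"
  proof (rule analytic_continuation[OF zeta_holomorphic open_half_plane_punctured,
        where U = "Complex (1/2) ` {a<..<b}" and \<xi> = ?c])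
    \<comment> \<open>Removing a point from a convex set keeps it connected unless its dimension is
      1.\<close>
    have "aff_dim {s. 0 < Re s} = 2"
      by (subst aff_dim_open) (auto simp: open_halfspace_Re_gt intro: exI[of _ 1])
    then show "connected ?S"
      by (intro connected_punctured_convex convex_halfspace_Re_gt) auto
    show "?c islimpt Complex (1/2) ` {a<..<b}"
      unfolding islimpt_approachable
    proof safe
      fix e :: real assume "0 < e"
      define \<delta> where "\<delta> = min (e / 2) ((b - a) / 4)"
      define t where "t = (a + b) / 2 + \<delta>"
      have "0 < \<delta>" "\<delta> \<le> e / 2" "\<delta> \<le> (b - a) / 4"
        using \<open>0 < e\<close> assms unfolding \<delta>_def by (simp, intro min.cobounded1, intro min.cobounded2)
      then have t: "a < t \<and> t < b \<and> t \<noteq> (a + b) / 2 \<and> \<bar>t - (a + b) / 2\<bar> < e"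
        using \<open>0 < e\<close> assms unfolding t_def by argo
      have "dist (Complex (1/2) t) ?c = \<bar>t - (a + b) / 2\<bar>"
        by (simp add: dist_norm cmod_def)
      then show "\<exists>x'\<in>Complex (1/2) ` {a<..<b}. x' \<noteq> ?c \<and> dist x' ?c < e"
        using t by (intro bexI[of _ "Complex (1/2) t"]) auto
    qed
    show "zeta z = 0" if z: "z \<in> Complex (1/2) ` {a<..<b}" for z
    proof -
      obtain t where t: "z = Complex (1/2) t" "a < t" "t < b" using z by auto
      then have "critical_sq t = 0" using neg by blast
      then show ?thesis by (simp add: critical_sq_def t)
    qed
  qed (auto simp: complex_eq_iff)
  then show False using zeta_2_nonzero by simp
qed

subsection \<open>The ladder\<close>

lemma ladder_equation_critical_sq:
  "ladder_equation \<mu> y0 T x \<longleftrightarrow> y0 \<le> x \<and>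
     integral {0..\<mu> x} (\<lambda>t. critical_sq t * exp (- 2 * t / x)) = integral {0..T} critical_sq"
  by (simp add: ladder_equation_def critical_sq_def[abs_def])

definition critical_int :: "real \<Rightarrow> real" where
  "critical_int T = integral {0..T} critical_sq"

lemma integrable_critical_sq: "critical_sq integrable_on {a..b}"
  by (intro integrable_continuous_real continuous_intros)

lemma critical_int_strict_mono:
  assumes "0 \<le> a" "a < b"
  shows "critical_int a < critical_int b"
proof -
  obtain t where "a < t" "t < b" "critical_sq t \<noteq> 0"
    using critical_sq_nonzero_between[OF assms(2)] by blast
  then have "0 < integral {a..b} critical_sq"
    using assms by (intro integral_pos_continuous[of _ _ _ t]) (auto intro: continuous_intros critical_sq_nonneg)
  moreover have "integral {0..a} critical_sq + integral {a..b} critical_sq = integral {0..b} critical_sq"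
    using assms by (intro Henstock_Kurzweil_Integration.integral_combine integrable_critical_sq) auto
  ultimately show ?thesis by (simp add: critical_int_def)
qed

lemma critical_int_0 [simp]: "critical_int 0 = 0"
  by (simp add: critical_int_def)

lemma critical_int_pos: "0 < T \<Longrightarrow> 0 < critical_int T"
  using critical_int_strict_mono[of 0 T] by simp

lemma critical_int_less_iff:
  "0 \<le> a \<Longrightarrow> 0 \<le> b \<Longrightarrow> critical_int a < critical_int b \<longleftrightarrow> a < b"
  using critical_int_strict_mono[of a b] critical_int_strict_mono[of b a]
  by (cases a b rule: linorder_cases) auto

lemma critical_int_has_derivative:
  assumes "0 < T"
  shows "(critical_int has_real_derivative critical_sq T) (at T)"
proof -
  have "(critical_int has_real_derivative critical_sq T) (at T within {0..T + 1})"
    unfolding critical_int_def[abs_def] using assms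
    by (intro integral_has_real_derivative continuous_intros) auto
  moreover have "at T within {0..T + 1} = at T"
    using assms by (intro at_within_interior) auto
  ultimately show ?thesis by simp
qed

lemma continuous_on_critical_int: "continuous_on {0..b} critical_int"
  unfolding critical_int_def[abs_def]
  by (intro indefinite_integral_continuous_1 integrable_critical_sq)

section \<open>The left side of the ladder equation and its derivative\<close>

locale ladder =
  fixes \<mu> :: "real \<Rightarrow> real" and y0 :: real
  assumes y0: "0 < y0"
    and smooth: "C_infinity_on {y0..} \<mu>"
    and mono: "mono_on {y0..} \<mu>"
    and unbounded: "\<not> bdd_above (\<mu> ` {y0..})"
    and growth: "\<forall>y\<ge>y0. 7 * y * ln y \<le> \<mu> y"
begin

definition kern :: "real \<Rightarrow> real \<Rightarrow> real" where
  "kern x t = critical_sq t * exp (- 2 * t / x)"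

definition F :: "real \<Rightarrow> real" where
  "F x = integral {0..\<mu> x} (kern x)"

lemma kern_nonneg: "0 \<le> kern x t"
  by (simp add: kern_def critical_sq_nonneg)

lemma continuous_on_kern [continuous_intros]: "continuous_on S (kern x)"
proof (cases "x = 0")
  \<comment> \<open>Here \<open>- 2 * t / 0\<close> is 0, so the exponential factor is constantly
    1.\<close>
  case True
  then show ?thesis
    unfolding kern_def[abs_def] by (auto intro!: continuous_intros)
qed (auto simp: kern_def[abs_def] intro!: continuous_intros)

lemma integrable_kern: "kern x integrable_on {a..b}"
  by (intro integrable_continuous_real continuous_intros)

lemma ladder_equation_iff: "ladder_equation \<mu> y0 T x \<longleftrightarrow> y0 \<le> x \<and> F x = critical_int T"
  by (simp add: ladder_equation_critical_sq F_def critical_int_def kern_def[abs_def])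

lemma mu_mono: "y0 \<le> x \<Longrightarrow> x \<le> y \<Longrightarrow> \<mu> x \<le> \<mu> y"
  using mono by (auto simp: mono_on_def)

text \<open>\<open>\<mu>\<close> may be nonpositive near \<open>y0\<close>; the integration range is
  then empty or a point. This excludes such \<open>x\<close> as solutions for positive
  \<open>T\<close>.\<close>

lemma F_nonpos: "\<mu> x \<le> 0 \<Longrightarrow> F x = 0"
  by (cases "\<mu> x = 0") (auto simp: F_def)

lemma kern_integral_mono: "a \<le> b \<Longrightarrow> integral {0..a} (kern x) \<le> integral {0..b} (kern x)"
  by (intro integral_subset_le integrable_kern) (auto simp: kern_nonneg)

text \<open>Since \<open>\<mu>\<close> is only weakly increasing, strictness comes from the kernel,
  which grows with \<open>x\<close> and does so strictly wherever \<open>t > 0\<close> and zeta does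
  not vanish.\<close>

lemma F_strict_mono:
  assumes "y0 \<le> x" "x < y" "0 < \<mu> x"
  shows "F x < F y"
proof -
  have x: "0 < x" using y0 assms by simp
  have le: "- 2 * t / x \<le> - 2 * t / y" if "0 \<le> t" for t
    using that x assms by (simp add: frac_le)
  obtain t where t: "0 < t" "t < \<mu> x" "critical_sq t \<noteq> 0"
    using critical_sq_nonzero_between[OF assms(3)] by blast
  have "- 2 * t / x < - 2 * t / y"
    using t x assms by (simp add: field_simps)
  then have "kern y t - kern x t \<noteq> 0"
    using t assms by (auto simp: kern_def)
  then have "0 < integral {0..\<mu> x} (\<lambda>t. kern y t - kern x t)"
    using t assms le
    by (intro integral_pos_continuous[of _ _ _ t] continuous_intros)
       (auto simp: kern_def intro!: mult_left_mono critical_sq_nonneg)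
  also have "\<dots> = integral {0..\<mu> x} (kern y) - integral {0..\<mu> x} (kern x)"
    by (intro integral_diff integrable_kern)
  also have "\<dots> \<le> F y - F x"
    using kern_integral_mono[OF mu_mono[of x y], of y] assms by (simp add: F_def)
  finally show ?thesis by simp
qed

lemma F_pos:
  assumes "0 < \<mu> x"
  shows "0 < F x"
proof -
  obtain t where "0 < t" "t < \<mu> x" "critical_sq t \<noteq> 0"
    using critical_sq_nonzero_between[OF assms] by blast
  then show ?thesis
    unfolding F_def
    by (intro integral_pos_continuous[of _ _ _ t] continuous_intros) (auto simp: kern_def critical_sq_nonneg)
qed

lemma F_le_critical_int:
  assumes "y0 \<le> x"
  shows "F x \<le> critical_int (\<mu> x)"
  unfolding F_def critical_int_def
proof (intro integral_le integrable_kern integrable_critical_sq)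
  fix t assume "t \<in> {0..\<mu> x}"
  then show "kern x t \<le> critical_sq t"
    using y0 assms by (auto simp: kern_def intro!: mult_left_le critical_sq_nonneg)
qed

text \<open>On the fixed range \<open>{0..A}\<close> the damping factor is at least
  \<open>exp (- 2 * A / y)\<close>, which tends to 1, and \<open>\<mu> y\<close> exceeds
  \<open>A\<close> for large \<open>y\<close>. With \<open>F_le_critical_int\<close> this gives
  \<open>F\<close> and \<open>critical_int\<close> the same supremum.\<close>

lemma F_eventually_gt:
  assumes "0 < A" "c < critical_int A"
  shows "\<exists>y>x. c < F y"
proof -
  obtain z where z: "y0 \<le> z" "A < \<mu> z"
    using unbounded by (force simp: bdd_above_def not_le)
  have "((\<lambda>y. exp (- 2 * A / y) * critical_int A) \<longlongrightarrow> exp 0 * critical_int A) at_top"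
    by (intro tendsto_intros tendsto_divide_0[OF tendsto_const]
        filterlim_at_top_imp_at_infinity filterlim_ident)
  then have "\<forall>\<^sub>F y in at_top. c < exp (- 2 * A / y) * critical_int A"
    using assms by (intro order_tendstoD(1)) auto
  then have "\<forall>\<^sub>F y in at_top. c < exp (- 2 * A / y) * critical_int A \<and> z \<le> y \<and> x < y"
    using eventually_ge_at_top[of z] eventually_gt_at_top[of x] by eventually_elim auto
  then obtain y where y: "c < exp (- 2 * A / y) * critical_int A" "z \<le> y" "x < y"
    using eventually_happens by force
  have y_pos: "0 < y" using y z y0 by simp
  have "exp (- 2 * A / y) * critical_int A = integral {0..A} (\<lambda>t. exp (- 2 * A / y) * critical_sq t)"
    by (simp add: critical_int_def)
  also have "\<dots> \<le> integral {0..A} (kern y)"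
    using y_pos
    by (intro integral_le integrable_kern integrable_continuous_real continuous_intros)
       (auto simp: kern_def mult.commute[of "critical_sq _"] divide_right_mono intro!: mult_right_mono critical_sq_nonneg)
  also have "\<dots> \<le> F y"
    unfolding F_def using z y mu_mono[of z y] by (intro kern_integral_mono) auto
  finally show ?thesis using y by (intro exI[of _ y]) auto
qed

text \<open>A threshold strictly beyond \<open>y0 + 1 > 1\<close>: there the logarithm is positive,
  so the growth condition makes \<open>\<mu>\<close> positive, and \<open>F\<close> is strictly
  increasing and differentiable from \<open>x0\<close> on.\<close>

definition x0 :: real where "x0 = y0 + 2"

lemma x0: "y0 + 1 < x0" "0 < x0"
  using y0 by (auto simp: x0_def)

lemma mu_pos:
  assumes "y0 + 1 < x"
  shows "0 < \<mu> x"
proof -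
  have "0 < 7 * x * ln x" using y0 assms by simp
  also have "\<dots> \<le> \<mu> x" using growth assms by simp
  finally show ?thesis .
qed

lemma mu_derivative:
  assumes "y0 < x"
  obtains D where "(\<mu> has_real_derivative D) (at x)" "0 \<le> D"
proof -
  obtain E where E: "\<forall>y\<in>{y0..}. E 0 y = \<mu> y"
      "\<forall>n. \<forall>y\<in>{y0..}. (E n has_real_derivative E (Suc n) y) (at y within {y0..})"
    using smooth unfolding C_infinity_on_def by blast
  have "(E 0 has_real_derivative E (Suc 0) x) (at x within {y0..})"
    using E(2) assms by auto
  moreover have "at x within {y0..} = at x"
    using assms by (intro at_within_interior) (auto simp: interior_real_atLeast)
  ultimately have "(E 0 has_real_derivative E (Suc 0) x) (at x)" by simp
  then have D: "(\<mu> has_real_derivative E (Suc 0) x) (at x)"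
    by (rule has_field_derivative_transform_within_open[of _ _ _ "{y0<..}"]) (use E(1) assms in auto)
  moreover have "0 \<le> E (Suc 0) x"
    using mono_on_imp_deriv_nonneg[OF mono D] assms by (simp add: interior_real_atLeast)
  ultimately show ?thesis using that by blast
qed

text \<open>\<open>F x\<close> is \<open>P x (\<mu> x)\<close>. The chain rule gives the sum of
  \<open>integral {0..\<mu> x} (k x)\<close>, which is positive, and \<open>kern x (\<mu> x)\<close>
  times the derivative of \<open>\<mu>\<close>, which is nonnegative.\<close>

lemma F_has_derivative:
  assumes "y0 + 1 < x"
  obtains D where "(F has_real_derivative D) (at x)" "0 < D"
proof -
  define P where "P = (\<lambda>x m. integral {0..m} (kern x))"
  define k where "k = (\<lambda>x t. critical_sq t * (exp (- 2 * t / x) * (2 * t / x\<^sup>2)))"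
  define X where "X = {y0 + 1<..}"
  define Y where "Y = {0::real<..}"
  have X: "0 < z" "0 < \<mu> z" if "z \<in> X" for z
    using that y0 mu_pos[of z] by (auto simp: X_def)
  have xX: "x \<in> X" using assms by (simp add: X_def)
  have mY: "\<mu> x \<in> Y" using X(2)[OF xX] by (simp add: Y_def)
  have k_cont: "continuous_on (X \<times> S) (\<lambda>(x, t). k x t)" for S
    unfolding k_def case_prod_beta
    by (intro continuous_intros continuous_on_compose2[OF continuous_on_critical_sq[of UNIV]])
       (use X(1) in \<open>force+\<close>)
  have "((\<lambda>y. integral (cbox 0 (\<mu> x)) (kern y)) has_field_derivative
      integral (cbox 0 (\<mu> x)) (k x)) (at x within X)"
  proof (rule leibniz_rule_field_derivative)
    fix z t assume z: "z \<in> X"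
    have "((\<lambda>x. exp (- 2 * t / x)) has_field_derivative exp (- 2 * t / z) * (2 * t / z\<^sup>2)) (at z within X)"
      using X(1)[OF z] by (auto intro!: derivative_eq_intros simp: power2_eq_square)
    then show "((\<lambda>x. kern x t) has_field_derivative k z t) (at z within X)"
      unfolding kern_def k_def by (rule DERIV_cmult)
  qed (use k_cont xX integrable_kern in \<open>auto simp: X_def\<close>)
  then have fx: "((\<lambda>y. P y (\<mu> x)) has_derivative (*) (integral {0..\<mu> x} (k x))) (at x within X)"
    by (simp add: P_def has_field_derivative_def)
  have fy: "(P z has_derivative blinfun_apply (blinfun_mult_right (kern z m))) (at m within Y)"
    if "z \<in> X" "m \<in> Y" for z m
  proof -
    have "(P z has_real_derivative kern z m) (at m within {0..m + 1})"
      unfolding P_def using that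
      by (intro integral_has_real_derivative continuous_intros) (auto simp: Y_def)
    moreover have "at m within {0..m + 1} = at m"
      using that by (intro at_within_interior) (auto simp: Y_def)
    ultimately show ?thesis
      by (simp add: has_field_derivative_def has_derivative_at_withinI)
  qed
  have "continuous_on (X \<times> Y) (\<lambda>p. kern (fst p) (snd p))"
    unfolding kern_def
    by (intro continuous_intros continuous_on_compose2[OF continuous_on_critical_sq[of UNIV]])
       (use X(1) in \<open>force+\<close>)
  then have "continuous_on (X \<times> Y) (\<lambda>p. blinfun_mult_right (kern (fst p) (snd p)))"
    by (rule bounded_linear.continuous_on[OF bounded_linear_blinfun_mult_right])
  then have "continuous (at (x, \<mu> x) within X \<times> Y) (\<lambda>(x, y). blinfun_mult_right (kern x y))"
    using xX mY by (simp add: continuous_on_eq_continuous_within case_prod_unfold)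
  \<comment> \<open>Total differentiability of \<open>P\<close>: the partial derivative in
    \<open>x\<close> is given at the point alone, the one in \<open>m\<close> is given on all of
    \<open>X \<times> Y\<close> and is continuous at the point.\<close>
  from has_derivative_partialsI[OF fx fy this mY]
  have "((\<lambda>(x, m). P x m) has_derivative
      (\<lambda>(a, b). integral {0..\<mu> x} (k x) * a + kern x (\<mu> x) * b)) (at (x, \<mu> x) within X \<times> Y)"
    by (simp add: Y_def)
  moreover have "at (x, \<mu> x) within X \<times> Y = at (x, \<mu> x)"
    using xX mY by (intro at_within_open open_Times) (auto simp: X_def Y_def)
  ultimately have P: "((\<lambda>(x, m). P x m) has_derivative
      (\<lambda>(a, b). integral {0..\<mu> x} (k x) * a + kern x (\<mu> x) * b)) (at (x, \<mu> x))"
    by simp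
  obtain D where D: "(\<mu> has_real_derivative D) (at x)" "0 \<le> D"
    using mu_derivative[of x] assms x0 by force
  have "((\<lambda>x. (x, \<mu> x)) has_derivative (\<lambda>h. (h, D * h))) (at x)"
    using D(1) by (intro has_derivative_Pair has_derivative_ident) (simp add: has_field_derivative_def)
  from has_derivative_compose[OF this P]
  have "((\<lambda>x. P x (\<mu> x)) has_derivative
      (\<lambda>h. integral {0..\<mu> x} (k x) * h + kern x (\<mu> x) * (D * h))) (at x)"
    by simp
  moreover have "(\<lambda>h. integral {0..\<mu> x} (k x) * h + kern x (\<mu> x) * (D * h)) =
      (*) (integral {0..\<mu> x} (k x) + kern x (\<mu> x) * D)"
    by (auto simp: algebra_simps)
  ultimately have "(F has_real_derivative integral {0..\<mu> x} (k x) + kern x (\<mu> x) * D) (at x)"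
    by (simp add: has_field_derivative_def P_def F_def[abs_def])
  moreover have "0 < integral {0..\<mu> x} (k x)"
  proof -
    obtain t where t: "0 < t" "t < \<mu> x" "critical_sq t \<noteq> 0"
      using critical_sq_nonzero_between[OF X(2)[OF xX]] by blast
    then show ?thesis using X[OF xX]
      by (intro integral_pos_continuous[of _ _ _ t])
         (auto simp: k_def critical_sq_nonneg intro!: continuous_intros)
  qed
  ultimately show ?thesis
    using that D(2) by (meson add_pos_nonneg kern_nonneg mult_nonneg_nonneg)
qed

section \<open>The solution of the ladder equation and its derivative\<close>

lemma ladder_phi_eq:
  assumes "0 < T" "y0 \<le> x" "F x = critical_int T"
  shows "T \<in> ladder_domain \<mu> y0" "ladder_phi \<mu> y0 T = x"
proof -
  have "\<exists>!x. ladder_equation \<mu> y0 T x"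
  proof (rule ex1I[of _ x])
    fix y assume "ladder_equation \<mu> y0 T y"
    then have y: "y0 \<le> y" "F y = F x" using assms(3) by (auto simp: ladder_equation_iff)
    \<comment> \<open>Uniqueness: a positive common value of \<open>F\<close> forces
      \<open>\<mu>\<close> to be positive at both solutions, where strict monotonicity
      applies.\<close>
    have pos: "0 < F x" using critical_int_pos assms by simp
    then have "0 < \<mu> x" "0 < \<mu> y"
      using F_nonpos[of x] F_nonpos[of y] y(2) by linarith+
    then show "y = x"
      using y assms(2) by (metis F_strict_mono less_irrefl linorder_neq_iff)
  qed (use assms in \<open>simp add: ladder_equation_iff\<close>)
  then show "T \<in> ladder_domain \<mu> y0" "ladder_phi \<mu> y0 T = x"
    unfolding ladder_phi_def using assms
    by (simp add: ladder_domain_def, intro the1_equality) (simp_all add: ladder_equation_iff)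
qed

lemma F_less_iff: "x0 \<le> x \<Longrightarrow> x0 \<le> y \<Longrightarrow> F x < F y \<longleftrightarrow> x < y"
  using F_strict_mono[of x y] F_strict_mono[of y x] mu_pos[of x] mu_pos[of y] x0
  by (cases x y rule: linorder_cases) auto

lemma continuous_on_F: "continuous_on {y0 + 1<..} F"
  by (rule continuous_at_imp_continuous_on) (metis F_has_derivative DERIV_isCont greaterThan_iff)

text \<open>Intermediate value theorem on \<open>{0..\<mu> x}\<close>: \<open>critical_int\<close>
  is 0 at the left end and at least \<open>F x\<close> at the right. Positivity of
  \<open>F x\<close> excludes \<open>T = 0\<close>.\<close>

lemma F_eq_critical_int:
  assumes "x0 \<le> x"
  obtains T where "0 < T" "critical_int T = F x"
proof -
  have pos: "0 < \<mu> x" using mu_pos[of x] assms x0 by simp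
  have "\<exists>T. 0 \<le> T \<and> T \<le> \<mu> x \<and> critical_int T = F x"
    using F_pos[OF pos] F_le_critical_int[of x] pos assms x0
    by (intro IVT' continuous_on_critical_int) auto
  then show ?thesis
    using F_pos[OF pos] that critical_int_0 by (metis less_eq_real_def less_irrefl)
qed

text \<open>The counterpart of \<open>x0\<close> on the side of \<open>T\<close>: the ladder
  solution maps the half-line beyond \<open>T0\<close> bijectively onto the one beyond
  \<open>x0\<close>.\<close>

definition T0 :: real where "T0 = (SOME T. 0 < T \<and> critical_int T = F x0)"

lemma T0: "0 < T0" "critical_int T0 = F x0"
proof -
  have "\<exists>T. 0 < T \<and> critical_int T = F x0"
    using F_eq_critical_int[of x0] by (metis order_refl)
  from someI_ex[OF this] show "0 < T0" "critical_int T0 = F x0"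
    by (auto simp: T0_def)
qed

text \<open>Intermediate value theorem for \<open>F\<close> between \<open>x0\<close> and some
  \<open>b\<close>. Such a \<open>b\<close> exists because \<open>critical_int T\<close> lies
  strictly below \<open>critical_int (T + 1)\<close>, hence below the supremum of
  \<open>F\<close>.\<close>

lemma ladder_phi_solves:
  assumes "T0 < T"
  shows "x0 < ladder_phi \<mu> y0 T" "F (ladder_phi \<mu> y0 T) = critical_int T" "T \<in> ladder_domain \<mu> y0"
proof -
  have G: "F x0 < critical_int T" "critical_int T < critical_int (T + 1)"
    using critical_int_less_iff[of T0 T] critical_int_less_iff[of T "T + 1"] assms T0 by simp_all
  obtain b where b: "x0 + 1 < b" "critical_int T < F b"
    using F_eventually_gt[of "T + 1" "critical_int T" "x0 + 1"] G(2) assms T0 by auto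
  have "\<exists>x. x0 \<le> x \<and> x \<le> b \<and> F x = critical_int T"
    using G b x0 by (intro IVT' continuous_on_subset[OF continuous_on_F]) auto
  then obtain x where x: "x0 < x" "F x = critical_int T"
    using G(1) by (metis less_eq_real_def less_irrefl)
  then show "x0 < ladder_phi \<mu> y0 T" "F (ladder_phi \<mu> y0 T) = critical_int T" "T \<in> ladder_domain \<mu> y0"
    using ladder_phi_eq[of T x] assms T0 x0 y0 by auto
qed

lemma ladder_phi_less_iff:
  assumes "T0 < S" "T0 < T"
  shows "ladder_phi \<mu> y0 S < ladder_phi \<mu> y0 T \<longleftrightarrow> S < T"
proof -
  have "F (ladder_phi \<mu> y0 S) < F (ladder_phi \<mu> y0 T) \<longleftrightarrow> ladder_phi \<mu> y0 S < ladder_phi \<mu> y0 T"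
    using ladder_phi_solves(1) assms by (intro F_less_iff) (simp_all add: less_imp_le)
  then show ?thesis
    using ladder_phi_solves(2) assms T0 by (simp add: critical_int_less_iff)
qed

lemma ladder_phi_surj:
  assumes "x0 < x"
  obtains T where "T0 < T" "ladder_phi \<mu> y0 T = x"
proof -
  obtain T where T: "0 < T" "critical_int T = F x"
    using F_eq_critical_int[of x] assms by auto
  have "critical_int T0 < critical_int T"
    using F_less_iff[of x0 x] assms T T0 by simp
  then have "T0 < T" using critical_int_less_iff[of T0 T] T T0 by simp
  moreover have "ladder_phi \<mu> y0 T = x"
    using ladder_phi_eq(2)[of T x] T assms x0 by simp
  ultimately show ?thesis using that by blast
qed

text \<open>The description in \<open>reverse_iterate\<close> ranges over the whole
  \<open>ladder_domain\<close>; this bound keeps the points up to \<open>T0\<close> from being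
  further candidates.\<close>

lemma ladder_phi_le:
  assumes "T \<in> ladder_domain \<mu> y0" "T \<le> T0"
  shows "ladder_phi \<mu> y0 T \<le> x0"
proof (rule ccontr)
  assume "\<not> ?thesis"
  then have "F x0 < F (ladder_phi \<mu> y0 T)" by (simp add: F_less_iff)
  moreover have "ladder_equation \<mu> y0 T (ladder_phi \<mu> y0 T)" "0 < T"
    using assms(1) theI'[of "ladder_equation \<mu> y0 T"] by (auto simp: ladder_domain_def ladder_phi_def)
  ultimately have "critical_int T0 < critical_int T"
    by (simp add: ladder_equation_iff T0)
  then show False
    using critical_int_less_iff[of T0 T] T0 \<open>0 < T\<close> assms(2) by simp
qed

text \<open>Beyond \<open>T0\<close> the solution is the inverse of \<open>F\<close> composed with
  \<open>critical_int\<close>; the inverse is differentiable because the derivative of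
  \<open>F\<close> is positive.\<close>

lemma ladder_phi_has_derivative:
  assumes "T0 < T"
  obtains D where "(ladder_phi \<mu> y0 has_real_derivative D) (at T)"
proof -
  let ?x = "ladder_phi \<mu> y0 T"
  define \<psi> where "\<psi> = the_inv_into {x0<..} F"
  have inj: "inj_on F {x0<..}"
    by (intro linorder_inj_onI) (metis F_less_iff greaterThan_iff less_eq_real_def less_irrefl, auto)
  obtain D where D: "(F has_real_derivative D) (at ?x)" "0 < D"
    using F_has_derivative[of ?x] ladder_phi_solves(1)[OF assms] x0 by auto
  have "(\<psi> has_real_derivative inverse D) (at (F ?x))"
  proof (rule has_field_derivative_inverse_strong[OF D(1)])
    show "continuous_on {x0<..} F"
      using x0 by (intro continuous_on_subset[OF continuous_on_F]) auto
  qed (use D ladder_phi_solves(1)[OF assms] inj in \<open>auto simp: \<psi>_def the_inv_into_f_f\<close>)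
  then have "(\<psi> has_real_derivative inverse D) (at (critical_int T))"
    by (simp add: ladder_phi_solves(2)[OF assms])
  from DERIV_chain2[OF this critical_int_has_derivative[of T]]
  have "((\<lambda>T. \<psi> (critical_int T)) has_real_derivative inverse D * critical_sq T) (at T)"
    using assms T0 by simp
  then have "(ladder_phi \<mu> y0 has_real_derivative inverse D * critical_sq T) (at T)"
  proof (rule has_field_derivative_transform_within_open[of _ _ _ "{T0<..}"])
    fix S assume "S \<in> {T0<..}"
    then show "\<psi> (critical_int S) = ladder_phi \<mu> y0 S"
      using ladder_phi_solves[of S] inj by (metis \<psi>_def greaterThan_iff the_inv_into_f_f)
  qed (use assms in auto)
  then show ?thesis using that by blast
qed

subsection \<open>Reverse iterations and generated points\<close>

declare reverse_iterate.simps(2) [simp del]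

abbreviation "h \<equiv> jacobs_ladder \<mu> y0"
abbreviation "Z \<equiv> Z2_tilde \<mu> y0"
abbreviation "rit \<equiv> reverse_iterate \<mu> y0"

lemma h_less_iff: "T0 < S \<Longrightarrow> T0 < T \<Longrightarrow> h S < h T \<longleftrightarrow> S < T"
  using ladder_phi_less_iff[of S T] by (simp add: jacobs_ladder_def)

lemma h_has_derivative:
  assumes "T0 < T"
  shows "(h has_real_derivative Z T) (at T)"
proof -
  obtain D where "(ladder_phi \<mu> y0 has_real_derivative D) (at T)"
    using ladder_phi_has_derivative[OF assms] .
  then have "(h has_real_derivative D / 2) (at T)"
    unfolding jacobs_ladder_def[abs_def] by (rule DERIV_cdivide)
  then show ?thesis
    unfolding Z2_tilde_def by (simp add: DERIV_imp_deriv)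
qed

text \<open>A value above \<open>x0 / 2\<close> is attained by the ladder beyond \<open>T0\<close>,
  exactly once there, and nowhere else in the domain, so the description is well defined.\<close>

lemma rev_Suc:
  assumes "x0 / 2 < rit c r"
  shows "T0 < rit c (Suc r)" "h (rit c (Suc r)) = rit c r"
proof -
  have "x0 < 2 * rit c r" using assms by simp
  then obtain T where T: "T0 < T" "h T = rit c r"
    by (rule ladder_phi_surj) (simp add: jacobs_ladder_def)
  have "rit c (Suc r) = T"
    unfolding reverse_iterate.simps(2)
  proof (rule the_equality)
    show "T \<in> ladder_domain \<mu> y0 \<and> h T = rit c r"
      using T ladder_phi_solves(3) by simp
    fix S assume S: "S \<in> ladder_domain \<mu> y0 \<and> h S = rit c r"
    have "\<not> S \<le> T0"
    proof
      assume "S \<le> T0"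
      then have "h S \<le> x0 / 2" using ladder_phi_le[of S] S by (simp add: jacobs_ladder_def)
      then show False using S assms by simp
    qed
    then have "T0 < S" by simp
    then show "S = T"
      using S T h_less_iff[of S T] h_less_iff[of T S] by simp
  qed
  then show "T0 < rit c (Suc r)" "h (rit c (Suc r)) = rit c r" using T by simp_all
qed

lemma filterlim_rev: "filterlim (\<lambda>c. rit c r) at_top at_top"
proof (induction r)
  case 0
  then show ?case by (simp add: filterlim_ident)
next
  case (Suc r)
  show ?case
    unfolding filterlim_at_top
  proof
    fix B
    \<comment> \<open>Raising \<open>B\<close> above \<open>T0\<close> makes the monotonicity of
      \<open>h\<close> applicable at \<open>M\<close>: exceeding \<open>h M\<close> one level below
      yields exceeding \<open>M\<close>.\<close>
    define M where "M = max B (T0 + 1)"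
    have "\<forall>\<^sub>F c in at_top. max (x0 / 2) (h M) < rit c r"
      using Suc unfolding filterlim_at_top_dense by blast
    then show "\<forall>\<^sub>F c in at_top. B \<le> rit c (Suc r)"
    proof eventually_elim
      case (elim c)
      then have "T0 < rit c (Suc r)" "h M < h (rit c (Suc r))"
        using rev_Suc[of c r] by simp_all
      then have "M < rit c (Suc r)"
        using h_less_iff[of M "rit c (Suc r)"] by (simp add: M_def)
      then show ?case by (simp add: M_def)
    qed
  qed
qed

text \<open>The bound \<open>x0 / 2\<close> guarantees the next reverse iterate; the bound
  \<open>T0\<close> places the iterate where the ladder is strictly increasing and
  differentiable.\<close>

definition far :: "nat \<Rightarrow> real \<Rightarrow> bool" where
  "far k c \<longleftrightarrow> (\<forall>r\<le>k. x0 / 2 < rit c r \<and> T0 < rit c r)"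

lemma eventually_far: "\<forall>\<^sub>F c in at_top. far k c"
proof -
  have "\<forall>\<^sub>F c in at_top. max (x0 / 2) T0 < rit c r" for r
    using filterlim_rev[of r] unfolding filterlim_at_top_dense by blast
  then have "\<forall>\<^sub>F c in at_top. \<forall>r\<in>{..k}. max (x0 / 2) T0 < rit c r"
    by (intro eventually_ball_finite ballI) simp_all
  then show ?thesis by (rule eventually_mono) (simp add: far_def)
qed

lemma far_mono: "far k c \<Longrightarrow> j \<le> k \<Longrightarrow> far j c"
  by (auto simp: far_def)

lemma far_Suc: "far k c \<Longrightarrow> r < k \<Longrightarrow> h (rit c (Suc r)) = rit c r"
  unfolding far_def by (meson less_imp_le rev_Suc(2))

lemma rev_less:
  assumes "far k c" "far k d" "c < d" "r \<le> k"
  shows "rit c r < rit d r"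
  using assms(4)
proof (induction r)
  case (Suc r)
  then have "h (rit c (Suc r)) < h (rit d (Suc r))"
    using far_Suc[OF assms(1), of r] far_Suc[OF assms(2), of r] by simp
  then show ?case
    using assms(1,2) Suc.prems h_less_iff by (simp only: far_def)
qed (use assms in simp)

lemma h_between:
  assumes "far k c" "far k d" "r < k" "rit c (Suc r) < t" "t < rit d (Suc r)"
  shows "rit c r < h t" "h t < rit d r"
proof -
  have "T0 < rit c (Suc r)" "T0 < rit d (Suc r)" using assms by (simp_all only: far_def Suc_le_eq)
  then have "h (rit c (Suc r)) < h t" "h t < h (rit d (Suc r))"
    using assms by (simp_all add: h_less_iff)
  then show "rit c r < h t" "h t < rit d r"
    using far_Suc[OF assms(1,3)] far_Suc[OF assms(2,3)] by simp_all
qed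

text \<open>Downward induction from \<open>k\<close>, each application of \<open>h\<close> lowering
  the level by one. At \<open>r = 0\<close> it places \<open>\<alpha> 0\<close> strictly between
  \<open>c\<close> and \<open>d\<close>.\<close>

lemma generated_between:
  assumes "far k c" "far k d" "\<alpha> k \<in> {rit c k <..< rit d k}"
    and "\<forall>r\<in>{1..k}. \<alpha> (r - 1) = h (\<alpha> r)" "r \<le> k"
  shows "\<alpha> r \<in> {rit c r <..< rit d r}"
  using assms(5)
proof (induction r rule: inc_induct)
  case (step r)
  then have "\<alpha> r = h (\<alpha> (Suc r))" using assms(4) by (metis atLeastAtMost_iff diff_Suc_1 le_add1 plus_1_eq_Suc Suc_le_eq)
  then show ?case using h_between[OF assms(1,2) step.hyps(2)] step.IH by simp
qed (use assms in simp)

lemma iterate_between: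
  assumes "far k c" "far k d" "rit c k < t" "t < rit d k" "j \<le> k"
  shows "rit c (k - j) < (h ^^ j) t \<and> (h ^^ j) t < rit d (k - j)"
  using assms(5)
proof (induction j)
  case (Suc j)
  then have "k - j = Suc (k - Suc j)" "k - Suc j < k" by simp_all
  then show ?case using h_between[OF assms(1,2), of "k - Suc j" "(h ^^ j) t"] Suc by simp
qed (use assms in simp)

lemma iterate_rev:
  assumes "far k c" "j \<le> k"
  shows "(h ^^ j) (rit c k) = rit c (k - j)"
  using assms(2)
proof (induction j)
  case (Suc j)
  then have "k - j = Suc (k - Suc j)" "k - Suc j < k" by simp_all
  then show ?case using far_Suc[OF assms(1), of "k - Suc j"] Suc by simp
qed simp

lemma iterate_has_derivative:
  assumes "\<And>i. i < j \<Longrightarrow> T0 < (h ^^ i) t"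
  shows "((h ^^ j) has_real_derivative (\<Prod>i<j. Z ((h ^^ i) t))) (at t)"
  using assms
proof (induction j)
  case (Suc j)
  have "((\<lambda>t. h ((h ^^ j) t)) has_real_derivative Z ((h ^^ j) t) * (\<Prod>i<j. Z ((h ^^ i) t))) (at t)"
    using Suc by (intro DERIV_chain2[of h] h_has_derivative) auto
  then show ?case by (simp add: mult.commute comp_def)
qed (simp add: id_def)

text \<open>The mean value theorem for the antiderivative of \<open>f\<close> composed with the \<open>k\<close>-th iterate of the
  ladder; no change of variables in the integral is needed.\<close>

lemma generated_exist:
  assumes "far k c" "far k d" "c < d" "continuous_on {c..d} f"
  shows "\<exists>\<alpha>. \<alpha> k \<in> {rit c k <..< rit d k} \<and> (\<forall>r\<in>{1..k}. \<alpha> (r - 1) = h (\<alpha> r)) \<and>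
    integral {c..d} f = f (\<alpha> 0) * (\<Prod>r = 1..k. Z (\<alpha> r)) * (rit d k - rit c k)"
proof -
  define \<Phi> where "\<Phi> = (\<lambda>x. integral {c..x} f)"
  define P where "P = (\<lambda>t. \<Prod>i<k. Z ((h ^^ i) t))"
  have less: "rit c k < rit d k" using rev_less[OF assms(1-3)] by simp
  \<comment> \<open>The end points, where the iterates are known exactly, are included, so that the
    derivative of \<open>h ^^ k\<close> exists on the closed interval.\<close>
  have betw: "rit c (k - j) \<le> (h ^^ j) t \<and> (h ^^ j) t \<le> rit d (k - j)"
    if t: "t \<in> {rit c k..rit d k}" and j: "j \<le> k" for t j
  proof -
    consider "t = rit c k" | "t = rit d k" | "rit c k < t" "t < rit d k"
      using t by fastforce
    then show ?thesis
      using iterate_between[OF assms(1,2), of t j] iterate_rev[of k _ j] rev_less[OF assms(1-3), of "k - j"]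
        assms j by cases auto
  qed
  have deriv: "((h ^^ k) has_real_derivative P t) (at t)" if "t \<in> {rit c k..rit d k}" for t
    unfolding P_def
  proof (rule iterate_has_derivative)
    fix i assume "i < k"
    then have "rit c (k - i) \<le> (h ^^ i) t" "T0 < rit c (k - i)"
      using betw[OF that, of i] assms(1) by (auto simp: far_def)
    then show "T0 < (h ^^ i) t" by simp
  qed
  have "continuous_on {rit c k..rit d k} (\<lambda>t. \<Phi> ((h ^^ k) t))"
  proof (rule continuous_on_compose2[of "{c..d}" \<Phi> _ "h ^^ k"])
    show "continuous_on {c..d} \<Phi>"
      unfolding \<Phi>_def using assms(4)
      by (intro indefinite_integral_continuous_1 integrable_continuous_real)
    show "continuous_on {rit c k..rit d k} (h ^^ k)"
      using deriv by (meson DERIV_isCont continuous_at_imp_continuous_on)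
    show "(h ^^ k) ` {rit c k..rit d k} \<subseteq> {c..d}"
      using betw[of _ k] by auto
  qed
  \<comment> \<open>Interior points only: at the ends \<open>h ^^ k\<close> takes the values
    \<open>c\<close> and \<open>d\<close>, where the derivative of \<open>\<Phi>\<close> is known
    only one-sidedly.\<close>
  moreover have "((\<lambda>t. \<Phi> ((h ^^ k) t)) has_derivative (*) (f ((h ^^ k) t) * P t)) (at t)"
    if "rit c k < t" "t < rit d k" for t
  proof -
    have in_cd: "(h ^^ k) t \<in> {c<..<d}" using iterate_between[OF assms(1,2) that, of k] by simp
    have "(\<Phi> has_real_derivative f ((h ^^ k) t)) (at ((h ^^ k) t) within {c..d})"
      unfolding \<Phi>_def using in_cd assms(4) by (intro integral_has_real_derivative) auto
    moreover have "at ((h ^^ k) t) within {c..d} = at ((h ^^ k) t)"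
      using in_cd by (intro at_within_interior) auto
    ultimately have "((\<lambda>t. \<Phi> ((h ^^ k) t)) has_real_derivative f ((h ^^ k) t) * P t) (at t)"
      using deriv[of t] that by (intro DERIV_chain2[of \<Phi>]) auto
    then show ?thesis by (simp add: has_field_derivative_def)
  qed
  ultimately obtain \<xi> where \<xi>: "rit c k < \<xi>" "\<xi> < rit d k"
      "\<Phi> ((h ^^ k) (rit d k)) - \<Phi> ((h ^^ k) (rit c k)) = f ((h ^^ k) \<xi>) * P \<xi> * (rit d k - rit c k)"
    using mvt[OF less, of "\<lambda>t. \<Phi> ((h ^^ k) t)" "\<lambda>t. (*) (f ((h ^^ k) t) * P t)"] by blast
  \<comment> \<open>The mean value point \<open>\<xi>\<close> becomes \<open>\<alpha> k\<close> and
    the ladder is applied downwards from it; the index \<open>i\<close> in \<open>P\<close>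
    corresponds to \<open>r = k - i\<close>.\<close>
  define \<alpha> where "\<alpha> = (\<lambda>r. (h ^^ (k - r)) \<xi>)"
  have "\<alpha> (r - 1) = h (\<alpha> r)" if "r \<in> {1..k}" for r
  proof -
    have "k - (r - 1) = Suc (k - r)" using that by auto
    then show ?thesis by (simp add: \<alpha>_def)
  qed
  moreover have "P \<xi> = (\<Prod>r = 1..k. Z (\<alpha> r))"
    unfolding P_def \<alpha>_def
    by (subst prod.nat_diff_reindex[symmetric]) (simp add: prod.atLeast1_atMost_eq)
  moreover have "\<Phi> ((h ^^ k) (rit d k)) - \<Phi> ((h ^^ k) (rit c k)) = integral {c..d} f"
    using iterate_rev[of k c k] iterate_rev[of k d k] assms by (simp add: \<Phi>_def)
  moreover have "\<alpha> 0 = (h ^^ k) \<xi>" "\<alpha> k = \<xi>" by (simp_all add: \<alpha>_def)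
  ultimately show ?thesis using \<xi> by (intro exI[of _ \<alpha>]) auto
qed

section \<open>Generated points and the power functions\<close>

lemma generated_points_iff:
  "generated_points \<mu> y0 f U L k \<alpha> \<longleftrightarrow>
     continuous_on {pi * real L..pi * real L + U} f \<and> (\<forall>t\<in>{pi * real L..pi * real L + U}. 0 \<le> f t) \<and>
     (\<exists>t\<in>{pi * real L..pi * real L + U}. f t \<noteq> 0) \<and> 1 \<le> k \<and>
     \<alpha> k \<in> {rit (pi * real L) k<..<rit (pi * real L + U) k} \<and>
     (\<forall>r\<in>{1..k}. \<alpha> (r - 1) = h (\<alpha> r)) \<and>
     integral {pi * real L..pi * real L + U} f =
       f (\<alpha> 0) * (\<Prod>r = 1..k. Z (\<alpha> r)) * (rit (pi * real L + U) k - rit (pi * real L) k)"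
  by (simp add: generated_points_def Let_def)

lemma generated_points_exist:
  assumes "far k (pi * real L)" "far k (pi * real L + U)" "0 < U" "1 \<le> k"
    and "continuous_on {pi * real L..pi * real L + U} f"
    and "\<forall>t\<in>{pi * real L..pi * real L + U}. 0 \<le> f t"
    and "s \<in> {pi * real L..pi * real L + U}" "f s \<noteq> 0"
  shows "\<exists>\<alpha>. generated_points \<mu> y0 f U L k \<alpha>"
proof -
  have "pi * real L < pi * real L + U" using assms(3) by simp
  from generated_exist[OF assms(1,2) this assms(5)] obtain \<alpha> where
    "\<alpha> k \<in> {rit (pi * real L) k<..<rit (pi * real L + U) k}"
    "\<forall>r\<in>{1..k}. \<alpha> (r - 1) = h (\<alpha> r)"
    "integral {pi * real L..pi * real L + U} f =
       f (\<alpha> 0) * (\<Prod>r = 1..k. Z (\<alpha> r)) * (rit (pi * real L + U) k - rit (pi * real L) k)"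
    by (elim exE conjE)
  moreover have "\<exists>t\<in>{pi * real L..pi * real L + U}. f t \<noteq> 0" using assms(7,8) by blast
  ultimately show ?thesis
    unfolding generated_points_iff using assms(4,5,6) by (intro exI[of _ \<alpha>] conjI)
qed

lemma generated_integral:
  assumes "generated_points \<mu> y0 f U L k \<alpha>"
  shows "integral {pi * real L..pi * real L + U} f =
    f (\<alpha> 0) * (\<Prod>r = 1..k. Z (\<alpha> r)) * (rit (pi * real L + U) k - rit (pi * real L) k)"
  using assms unfolding generated_points_iff by (elim conjE)

text \<open>Makes the shifted points in the quotient of the formula positive, as the passage to
  logarithms requires.\<close>

lemma generated_0_gt:
  assumes "far k (pi * real L)" "far k (pi * real L + U)" "generated_points \<mu> y0 f U L k \<alpha>"
  shows "pi * real L < \<alpha> 0"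
proof -
  have 1: "\<alpha> k \<in> {rit (pi * real L) k<..<rit (pi * real L + U) k}"
    using assms(3) unfolding generated_points_iff by (elim conjE)
  have 2: "\<forall>r\<in>{1..k}. \<alpha> (r - 1) = h (\<alpha> r)"
    using assms(3) unfolding generated_points_iff by (elim conjE)
  from generated_between[OF assms(1,2) 1 2 le0] show ?thesis by simp
qed

text \<open>Splitting the product reduces this to \<open>powr_elimination\<close>. The factor
  \<open>g\<close> stays arbitrary, to be filled with the values along the points of the squared
  sine or cosine.\<close>

lemma generated_powr_product:
  fixes p q :: real
  assumes far: "far k (pi * real L)" "far k (pi * real L + U)" and pos: "0 < U" "0 < p" "0 < q" "p \<noteq> q"
    and gen: "generated_points \<mu> y0 (\<lambda>t. (t - pi * real L) powr p) U L k \<alpha>"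
      "generated_points \<mu> y0 (\<lambda>t. (t - pi * real L) powr q) U L k \<beta>"
  shows "(\<Prod>r = 1..k. g r * Z (\<alpha> r) powr (q / (p - q)) * Z (\<beta> r) powr (- p / (p - q)))
      / ((\<beta> 0 - pi * real L) / (\<alpha> 0 - pi * real L)) powr (p * q / (p - q)) =
    (\<Prod>r = 1..k. g r) * (rit (pi * real L + U) k - rit (pi * real L) k) / U *
      ((1 + q) powr (1 / q) / (1 + p) powr (1 / p)) powr (p * q / (p - q))"
proof -
  let ?D = "rit (pi * real L + U) k - rit (pi * real L) k"
  let ?A = "\<Prod>r = 1..k. Z (\<alpha> r)" and ?B = "\<Prod>r = 1..k. Z (\<beta> r)"
  have x: "0 < \<alpha> 0 - pi * real L" "0 < \<beta> 0 - pi * real L"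
    using gen[THEN generated_0_gt[OF far]] by simp_all
  have D: "0 < ?D" using rev_less[OF far, of k] pos(1) by simp
  have A: "U powr (p + 1) / (p + 1) = (\<alpha> 0 - pi * real L) powr p * ?A * ?D"
    using generated_integral[OF gen(1)] integral_powr_shift[OF pos(1,2), of "pi * real L"] by simp
  have B: "U powr (q + 1) / (q + 1) = (\<beta> 0 - pi * real L) powr q * ?B * ?D"
    using generated_integral[OF gen(2)] integral_powr_shift[OF pos(1,3), of "pi * real L"] by simp
  have "(\<Prod>r = 1..k. g r * Z (\<alpha> r) powr (q / (p - q)) * Z (\<beta> r) powr (- p / (p - q))) =
      (\<Prod>r = 1..k. g r) * (?A powr (q / (p - q)) * ?B powr (- p / (p - q)))"
    by (simp add: prod.distrib prod_powr_distrib mult.assoc)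
  then show ?thesis
    using powr_elimination[OF pos(2,3,4) x pos(1) D A B] by (simp add: mult.assoc flip: times_divide_eq_right)
qed

end

theorem theorem1:
  fixes \<mu> :: "real \<Rightarrow> real" and y0 :: real and k0 :: nat
  assumes "0 < y0"
    and "C_infinity_on {y0..} \<mu>"
    and "mono_on {y0..} \<mu>"
    and "\<not> bdd_above (\<mu> ` {y0..})"
    and "\<forall>y\<ge>y0. 7 * y * ln y \<le> \<mu> y"
  shows "\<exists>L0::nat. \<forall>L\<ge>L0. \<forall>U\<in>{0<..<pi/2}. \<forall>\<Delta>3>0. \<forall>\<Delta>4>0. \<Delta>3 \<noteq> \<Delta>4 \<longrightarrow>
    (\<forall>k1\<in>{1..k0}. \<forall>k2\<in>{1..k0}.
      (let Z = Z2_tilde \<mu> y0;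
           f1 = (\<lambda>t. (sin t)\<^sup>2);
           f2 = (\<lambda>t. (cos t)\<^sup>2);
           f3 = (\<lambda>t. (t - pi * real L) powr \<Delta>3);
           f4 = (\<lambda>t. (t - pi * real L) powr \<Delta>4);
           generated = (\<lambda>\<alpha> :: nat \<Rightarrow> nat \<Rightarrow> nat \<Rightarrow> real.
             generated_points \<mu> y0 f1 U L k1 (\<alpha> 1 k1) \<and>
             generated_points \<mu> y0 f2 U L k2 (\<alpha> 2 k2) \<and>
             (\<forall>k\<in>{k1, k2}. generated_points \<mu> y0 f3 U L k (\<alpha> 3 k) \<and>
                            generated_points \<mu> y0 f4 U L k (\<alpha> 4 k)))
       in (\<exists>\<alpha>. generated \<alpha>) \<and>
          (\<forall>\<alpha>. generated \<alpha> \<longrightarrow>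
            (\<Prod>r = 1..k2. Z (\<alpha> 2 k2 r) * Z (\<alpha> 3 k2 r) powr (\<Delta>4 / (\<Delta>3 - \<Delta>4))
                            * Z (\<alpha> 4 k2 r) powr (- \<Delta>3 / (\<Delta>3 - \<Delta>4)))
              / ((\<alpha> 4 k2 0 - pi * real L) / (\<alpha> 3 k2 0 - pi * real L))
                  powr (\<Delta>3 * \<Delta>4 / (\<Delta>3 - \<Delta>4))
              * (cos (\<alpha> 2 k2 0))\<^sup>2
          + (\<Prod>r = 1..k1. Z (\<alpha> 1 k1 r) * Z (\<alpha> 3 k1 r) powr (\<Delta>4 / (\<Delta>3 - \<Delta>4))
                            * Z (\<alpha> 4 k1 r) powr (- \<Delta>3 / (\<Delta>3 - \<Delta>4)))
              / ((\<alpha> 4 k1 0 - pi * real L) / (\<alpha> 3 k1 0 - pi * real L))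
                  powr (\<Delta>3 * \<Delta>4 / (\<Delta>3 - \<Delta>4))
              * (sin (\<alpha> 1 k1 0))\<^sup>2
          = ((1 + \<Delta>4) powr (1 / \<Delta>4) / (1 + \<Delta>3) powr (1 / \<Delta>3))
              powr (\<Delta>3 * \<Delta>4 / (\<Delta>3 - \<Delta>4)))))"
proof -
  interpret ladder \<mu> y0
    using assms by unfold_locales
  obtain C where C: "\<And>c. C \<le> c \<Longrightarrow> far k0 c"
    using eventually_far[of k0] by (auto simp: eventually_at_top_linorder)
  show ?thesis
    unfolding Let_def
  \<comment> \<open>\<open>C\<close> is chosen before \<open>L\<close>, \<open>U\<close> and the
    exponents. Since pi is at least 1, \<open>L\<close> beyond \<open>C\<close> puts
    \<open>?c\<close> and \<open>?c + U\<close> beyond \<open>C\<close> as well.\<close>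
  proof (rule exI[of _ "nat \<lceil>C\<rceil>"], intro allI ballI impI, goal_cases)
    case (1 L U \<Delta>3 \<Delta>4 k1 k2)
    let ?c = "pi * real L"
    have "C \<le> real L" using 1(1) by linarith
    also have "real L \<le> ?c" using pi_gt3 by (simp add: mult_ge1_I mult_le_cancel_right1)
    finally have "C \<le> ?c" .
    have U: "0 < U" "U < pi / 2" using 1(2) by simp_all
    have far: "far k ?c" "far k (?c + U)" if "k \<in> {k1, k2}" for k
    proof -
      have "far k0 ?c" "far k0 (?c + U)" using C[of ?c] C[of "?c + U"] \<open>C \<le> ?c\<close> U by simp_all
      moreover have "k \<le> k0" using that 1(6,7) by auto
      ultimately show "far k ?c" "far k (?c + U)" using far_mono by blast+
    qed
    have k: "1 \<le> k1" "1 \<le> k2" using 1(6,7) by simp_all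
    \<comment> \<open>The squared sine vanishes at the left end, so its nonzero value is taken at
      the right end; for the squared cosine the left end serves.\<close>
    have "sin U \<noteq> 0" using sin_gt_zero[of U] U by simp
    then have "sin (?c + U) \<noteq> 0" by (simp add: sin_add)
    then have "\<exists>\<alpha>. generated_points \<mu> y0 (\<lambda>t. (sin t)\<^sup>2) U L k1 \<alpha>"
      using far k U by (intro generated_points_exist[where s = "?c + U"] continuous_intros) simp_all
    moreover have "\<exists>\<alpha>. generated_points \<mu> y0 (\<lambda>t. (cos t)\<^sup>2) U L k2 \<alpha>"
      using far k U by (intro generated_points_exist[where s = "?c"] continuous_intros) simp_all
    ultimately obtain \<alpha>1 \<alpha>2 where "generated_points \<mu> y0 (\<lambda>t. (sin t)\<^sup>2) U L k1 \<alpha>1"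
        "generated_points \<mu> y0 (\<lambda>t. (cos t)\<^sup>2) U L k2 \<alpha>2"
      by blast
    moreover have "\<exists>\<alpha>. generated_points \<mu> y0 (\<lambda>t. (t - ?c) powr p) U L k \<alpha>"
      if "0 < p" "k \<in> {k1, k2}" for p k
    proof (rule generated_points_exist[where s = "?c + U"])
      show "continuous_on {?c..?c + U} (\<lambda>t. (t - ?c) powr p)"
        using that by (intro continuous_on_powr' continuous_intros) auto
    qed (use far[OF that(2)] k that U in auto)
    then obtain \<gamma> where "\<And>p k. 0 < p \<Longrightarrow> k \<in> {k1, k2} \<Longrightarrow>
        generated_points \<mu> y0 (\<lambda>t. (t - ?c) powr p) U L k (\<gamma> p k)"
      by metis
    \<comment> \<open>One family \<open>\<gamma>\<close> supplies the points of the power functions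
      for both values of \<open>k\<close>, so the choice stays consistent when
      \<open>k1 = k2\<close>.\<close>
    ultimately have ex: "\<exists>\<alpha> :: nat \<Rightarrow> nat \<Rightarrow> nat \<Rightarrow> real.
        generated_points \<mu> y0 (\<lambda>t. (sin t)\<^sup>2) U L k1 (\<alpha> 1 k1) \<and>
        generated_points \<mu> y0 (\<lambda>t. (cos t)\<^sup>2) U L k2 (\<alpha> 2 k2) \<and>
        (\<forall>k\<in>{k1, k2}. generated_points \<mu> y0 (\<lambda>t. (t - ?c) powr \<Delta>3) U L k (\<alpha> 3 k) \<and>
          generated_points \<mu> y0 (\<lambda>t. (t - ?c) powr \<Delta>4) U L k (\<alpha> 4 k))"
      using 1(3,4)
      by (intro exI[of _ "\<lambda>i k. if i = 1 then \<alpha>1 else if i = 2 then \<alpha>2 else if i = 3 then \<gamma> \<Delta>3 k else \<gamma> \<Delta>4 k"])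
         simp
    show ?case
    proof (intro conjI ex allI impI, elim conjE)
      fix \<alpha> :: "nat \<Rightarrow> nat \<Rightarrow> nat \<Rightarrow> real"
      assume gen: "generated_points \<mu> y0 (\<lambda>t. (sin t)\<^sup>2) U L k1 (\<alpha> 1 k1)"
          "generated_points \<mu> y0 (\<lambda>t. (cos t)\<^sup>2) U L k2 (\<alpha> 2 k2)"
          "\<forall>k\<in>{k1, k2}. generated_points \<mu> y0 (\<lambda>t. (t - ?c) powr \<Delta>3) U L k (\<alpha> 3 k) \<and>
            generated_points \<mu> y0 (\<lambda>t. (t - ?c) powr \<Delta>4) U L k (\<alpha> 4 k)"
      let ?K = "((1 + \<Delta>4) powr (1 / \<Delta>4) / (1 + \<Delta>3) powr (1 / \<Delta>3)) powr (\<Delta>3 * \<Delta>4 / (\<Delta>3 - \<Delta>4))"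
      \<comment> \<open>With \<open>g\<close> and \<open>w\<close> taken from the squared sine or
        cosine, the right side is the integral of that function times \<open>?K / U\<close>.\<close>
      have factor: "(\<Prod>r = 1..k. g r * Z (\<alpha> 3 k r) powr (\<Delta>4 / (\<Delta>3 - \<Delta>4)) * Z (\<alpha> 4 k r) powr (- \<Delta>3 / (\<Delta>3 - \<Delta>4)))
          / ((\<alpha> 4 k 0 - ?c) / (\<alpha> 3 k 0 - ?c)) powr (\<Delta>3 * \<Delta>4 / (\<Delta>3 - \<Delta>4)) * w =
        w * (\<Prod>r = 1..k. g r) * (rit (?c + U) k - rit ?c k) * (?K / U)" if "k \<in> {k1, k2}" for k g w
      proof -
        have "generated_points \<mu> y0 (\<lambda>t. (t - ?c) powr \<Delta>3) U L k (\<alpha> 3 k)"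
            "generated_points \<mu> y0 (\<lambda>t. (t - ?c) powr \<Delta>4) U L k (\<alpha> 4 k)"
          using gen(3) that by blast+
        from generated_powr_product[OF far[OF that] U(1) 1(3,4,5) this, of g]
        show ?thesis by (simp only: mult_ac times_divide_eq_right times_divide_eq_left)
      qed
      have "(cos (\<alpha> 2 k2 0))\<^sup>2 * (\<Prod>r = 1..k2. Z (\<alpha> 2 k2 r)) * (rit (?c + U) k2 - rit ?c k2) =
          integral {?c..?c + U} (\<lambda>t. (cos t)\<^sup>2)"
        using generated_integral[OF gen(2)] by simp
      moreover have "(sin (\<alpha> 1 k1 0))\<^sup>2 * (\<Prod>r = 1..k1. Z (\<alpha> 1 k1 r)) * (rit (?c + U) k1 - rit ?c k1) =
          integral {?c..?c + U} (\<lambda>t. (sin t)\<^sup>2)"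
        using generated_integral[OF gen(1)] by simp
      ultimately have "(cos (\<alpha> 2 k2 0))\<^sup>2 * (\<Prod>r = 1..k2. Z (\<alpha> 2 k2 r)) * (rit (?c + U) k2 - rit ?c k2) * (?K / U) +
          (sin (\<alpha> 1 k1 0))\<^sup>2 * (\<Prod>r = 1..k1. Z (\<alpha> 1 k1 r)) * (rit (?c + U) k1 - rit ?c k1) * (?K / U) =
          (integral {?c..?c + U} (\<lambda>t. (cos t)\<^sup>2) + integral {?c..?c + U} (\<lambda>t. (sin t)\<^sup>2)) * (?K / U)"
        by (simp only: distrib_right)
      also have "\<dots> = ?K"
        using integral_cos_sq_sin_sq[of ?c "?c + U"] U by simp
      finally show "(\<Prod>r = 1..k2. Z (\<alpha> 2 k2 r) * Z (\<alpha> 3 k2 r) powr (\<Delta>4 / (\<Delta>3 - \<Delta>4))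
                            * Z (\<alpha> 4 k2 r) powr (- \<Delta>3 / (\<Delta>3 - \<Delta>4)))
              / ((\<alpha> 4 k2 0 - pi * real L) / (\<alpha> 3 k2 0 - pi * real L))
                  powr (\<Delta>3 * \<Delta>4 / (\<Delta>3 - \<Delta>4))
              * (cos (\<alpha> 2 k2 0))\<^sup>2
          + (\<Prod>r = 1..k1. Z (\<alpha> 1 k1 r) * Z (\<alpha> 3 k1 r) powr (\<Delta>4 / (\<Delta>3 - \<Delta>4))
                            * Z (\<alpha> 4 k1 r) powr (- \<Delta>3 / (\<Delta>3 - \<Delta>4)))
              / ((\<alpha> 4 k1 0 - pi * real L) / (\<alpha> 3 k1 0 - pi * real L))
                  powr (\<Delta>3 * \<Delta>4 / (\<Delta>3 - \<Delta>4))
              * (sin (\<alpha> 1 k1 0))\<^sup>2 = ?K"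
        using factor[of k2 "\<lambda>r. Z (\<alpha> 2 k2 r)" "(cos (\<alpha> 2 k2 0))\<^sup>2"]
          factor[of k1 "\<lambda>r. Z (\<alpha> 1 k1 r)" "(sin (\<alpha> 1 k1 0))\<^sup>2"] by (simp only: insert_iff simp_thms)
    qed
  qed
qed

end
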